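(* Let $p\ge2$ and $c\ge3$ be integers, and define $$q(p,c)=\begin{cases}\min\{p,c\},&c\text{ is odd},\\ \min\{2p,c\},&c\text{ is even}.\end{cases}$$ Then $$Z_-(P_p\square C_c)=q(p,c)\qquad\text{and}\qquad \gamma_{\mathrm{gr}}^t(P_p\square C_c)=pc-q(p,c).$$
   Context: All graphs are finite and simple. $P_n$ and $C_n$ are the path and the cycle on $n$ vertices. The Cartesian product $G\square H$ has vertex set $V(G)\times V(H)$, with $(u,x)$ adjacent to $(v,y)$ iff either $u=v$ and $xy\in E(H)$, or $x=y$ and $uv\in E(G)$. $N_G(v)$ denotes the open neighborhood of $v$. Skew zero forcing: vertices are colored blue or white. If a vertex $u$ of either color has exactly one white neighbor $v$, then $u$ may force $v$, i.e. $v$ becomes blue. A set $B\subseteq V(G)$ is a skew zero forcing set if, starting with exactly the vertices of $B$ blue, repeated legal forces can color all vertices blue. $Z_-(G)$ is the minimum cardinality of a skew zero forcing set. Grundy total domination: for $G$ without isolated vertices, a sequence $(v_1,\ldots,v_k)$ of distinct vertices is a legal open-neighborhood sequence if $N_G(v_i)\setminus\bigcup_{j=1}^{i-1}N_G(v_j)\neq\varnothing$ for every $1\le i\le k$. $\gamma_{\mathrm{gr}}^t(G)$ is the maximum length of a legal open-neighborhood sequence. *)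

theory Defs
  imports "Graph_Theory.Graph_Theory"
begin

text \<open>
  Finite simple graphs are the digraphs of Graph\_Theory without parallel arcs that satisfy
  \<^locale>\<open>pair_graph\<close>: finite, loop-free, and with a symmetric arc relation, so that an edge
  \<open>uv\<close> is the pair of arcs \<open>(u, v)\<close> and \<open>(v, u)\<close>.
\<close>

definition path_graph :: "nat \<Rightarrow> nat pair_pre_digraph" where
  "path_graph n = \<lparr> pverts = {..<n},
     parcs = {(i, j). i < n \<and> j < n \<and> (j = Suc i \<or> i = Suc j)} \<rparr>"

text \<open>Only meant for \<open>n \<ge> 3\<close>: the formula gives a loop for \<open>n = 1\<close> and a single edge for \<open>n = 2\<close>.\<close>

definition cycle_graph :: "nat \<Rightarrow> nat pair_pre_digraph" where
  "cycle_graph n = \<lparr> pverts = {..<n},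
     parcs = {(i, j). i < n \<and> j < n \<and> (j = Suc i mod n \<or> i = Suc j mod n)} \<rparr>"

definition cartesian_product ::
  "'a pair_pre_digraph \<Rightarrow> 'b pair_pre_digraph \<Rightarrow> ('a \<times> 'b) pair_pre_digraph" (infixr "\<box>" 70)
where
  "G \<box> H = \<lparr> pverts = pverts G \<times> pverts H,
     parcs = {((u, x), (v, y)). u \<in> pverts G \<and> v \<in> pverts G \<and> x \<in> pverts H \<and> y \<in> pverts H \<and>
                (u = v \<and> (x, y) \<in> parcs H \<or> x = y \<and> (u, v) \<in> parcs G)} \<rparr>"

definition open_nbhd :: "'a pair_pre_digraph \<Rightarrow> 'a \<Rightarrow> 'a set" where
  "open_nbhd G v = {u. (v, u) \<in> parcs G}"

text \<open>\<open>skew_force G B B'\<close>: one legal force leads from the set \<open>B\<close> of blue vertices to \<open>B'\<close>.\<close>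

inductive skew_force :: "'a pair_pre_digraph \<Rightarrow> 'a set \<Rightarrow> 'a set \<Rightarrow> bool"
  for G :: "'a pair_pre_digraph"
where
  "u \<in> pverts G \<Longrightarrow> open_nbhd G u - B = {v} \<Longrightarrow> skew_force G B (insert v B)"

definition skew_zero_forcing_set :: "'a pair_pre_digraph \<Rightarrow> 'a set \<Rightarrow> bool" where
  "skew_zero_forcing_set G B \<longleftrightarrow> B \<subseteq> pverts G \<and> (skew_force G)\<^sup>*\<^sup>* B (pverts G)"

definition skew_zero_forcing_number :: "'a pair_pre_digraph \<Rightarrow> nat" where
  "skew_zero_forcing_number G = Min {card B | B. skew_zero_forcing_set G B}"

definition legal_open_nbhd_sequence :: "'a pair_pre_digraph \<Rightarrow> 'a list \<Rightarrow> bool" where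
  "legal_open_nbhd_sequence G vs \<longleftrightarrow> set vs \<subseteq> pverts G \<and> distinct vs \<and>
     (\<forall>i < length vs. open_nbhd G (vs ! i) - (\<Union>j<i. open_nbhd G (vs ! j)) \<noteq> {})"

text \<open>
  Usually defined for graphs without isolated vertices; the formula needs no such restriction, and
  \<open>no_isolated_path_cycle\<close> below shows that it is met by the graphs considered here.
\<close>

definition grundy_total_domination_number :: "'a pair_pre_digraph \<Rightarrow> nat" where
  "grundy_total_domination_number G = Max {length vs | vs. legal_open_nbhd_sequence G vs}"

definition q :: "nat \<Rightarrow> nat \<Rightarrow> nat" where
  "q p c = (if odd c then min p c else min (2 * p) c)"

text \<open>\<^const>\<open>Min\<close> and \<^const>\<open>Max\<close> range over finite nonempty sets whenever the graph is finite.\<close>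

lemma skew_zero_forcing_sets_finite_nonempty:
  assumes "finite (pverts G)"
  shows "finite {card B | B. skew_zero_forcing_set G B}"
    and "{card B | B. skew_zero_forcing_set G B} \<noteq> {}"
proof -
  have "{card B | B. skew_zero_forcing_set G B} \<subseteq> card ` Pow (pverts G)"
    by (auto simp: skew_zero_forcing_set_def)
  then show "finite {card B | B. skew_zero_forcing_set G B}"
    using assms by (meson finite_Pow_iff finite_imageI finite_subset)
  have "skew_zero_forcing_set G (pverts G)"
    by (simp add: skew_zero_forcing_set_def)
  then show "{card B | B. skew_zero_forcing_set G B} \<noteq> {}" by blast
qed

lemma legal_open_nbhd_sequences_finite_nonempty:
  assumes "finite (pverts G)"
  shows "finite {length vs | vs. legal_open_nbhd_sequence G vs}"
    and "{length vs | vs. legal_open_nbhd_sequence G vs} \<noteq> {}"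
proof -
  have "{length vs | vs. legal_open_nbhd_sequence G vs} \<subseteq> {..card (pverts G)}"
    using assms by (auto simp: legal_open_nbhd_sequence_def)
      (metis card_mono distinct_card)
  then show "finite {length vs | vs. legal_open_nbhd_sequence G vs}"
    using finite_subset by blast
  have "legal_open_nbhd_sequence G []"
    by (simp add: legal_open_nbhd_sequence_def)
  then show "{length vs | vs. legal_open_nbhd_sequence G vs} \<noteq> {}" by blast
qed

lemma pair_graph_iff:
  "pair_graph G \<longleftrightarrow> finite (pverts G) \<and> parcs G \<subseteq> pverts G \<times> pverts G \<and>
     sym (parcs G) \<and> irrefl (parcs G)"
  (is "?L \<longleftrightarrow> ?R")
proof
  assume ?L
  then interpret pair_graph G .
  show ?R
    using pair_finite_verts pair_sym_arcs pair_no_loops wellformed'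
    by (auto simp: symmetric_def irrefl_def) blast
next
  assume r: ?R
  then have "finite (parcs G)" by (meson finite_SigmaI finite_subset)
  with r show ?L
    by unfold_locales (auto simp: symmetric_def irrefl_def)
qed

lemma pair_graph_path_graph: "pair_graph (path_graph n)"
  by (auto simp: pair_graph_iff path_graph_def sym_def irrefl_def)

lemma pair_graph_cycle_graph: "n \<ge> 2 \<Longrightarrow> pair_graph (cycle_graph n)"
  by (auto simp: pair_graph_iff cycle_graph_def sym_def irrefl_def mod_Suc)

lemma pair_graph_cartesian_product:
  "pair_graph G \<Longrightarrow> pair_graph H \<Longrightarrow> pair_graph (G \<box> H)"
  by (auto simp: pair_graph_iff cartesian_product_def sym_def irrefl_def)

lemma no_isolated_path_cycle:
  assumes "c \<ge> 3" "v \<in> pverts (path_graph p \<box> cycle_graph c)"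
  shows "open_nbhd (path_graph p \<box> cycle_graph c) v \<noteq> {}"
proof -
  obtain i j where v: "v = (i, j)" by (cases v)
  have "(i, Suc j mod c) \<in> open_nbhd (path_graph p \<box> cycle_graph c) v"
    using assms unfolding v
    by (auto simp: open_nbhd_def cartesian_product_def path_graph_def cycle_graph_def)
  then show ?thesis by blast
qed

lemma q_le: "p \<ge> 1 \<Longrightarrow> q p c \<le> p * c"
  by (auto simp: q_def min_def intro: order_trans[of _ c])

end

theory Submission
  imports Defs
begin

text \<open>
  Skew zero forcing and legal sequences are two descriptions of one combinatorial object. The
  vertices that perform the forces, in the order in which they act, form a legal sequence: the
  vertex forced at a step was white until then, so no earlier forcing vertex is adjacent to it.
  Conversely, choose for each vertex of a legal sequence a neighbour that is adjacent to no earlier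
  vertex of the sequence, and colour everything except these chosen neighbours blue; then the
  vertices of the sequence, in order, force them. Hence \<open>Z\<^sub>- + \<gamma>\<close> is the number of vertices
  (\<open>skew_zero_forcing_plus_grundy\<close>), and only the Grundy number of the cylinder remains.

  Long legal sequences are explicit. Sweeping along the rows leaves out the last row, at a cost of
  \<open>c\<close>; sweeping around the cycle leaves out two adjacent columns, at a cost of \<open>2 * p\<close>. If \<open>c\<close> is
  odd, the second sweep can be done on one parity class of the double cover, the cylinder over the
  cycle of length \<open>2 * c\<close>, where two adjacent columns contain only \<open>p\<close> vertices.

  The upper bound is an expansion argument. If the sequence has length \<open>k\<close>, then each of the \<open>n\<close>
  vertices available as neighbours is claimed at most once, so every prefix \<open>S\<close> satisfies
  \<open>card (N S) - card S \<le> n - k\<close>. Assume first that \<open>c\<close> is odd, and call a row full or empty according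
  to \<open>S\<close>. A row that is neither full nor empty expands inside its own cycle, so if all \<open>p\<close> rows are
  of this kind then the excess \<open>card (N S) - card S\<close> is at least \<open>p\<close>. If there are both a full row
  and an empty row, then the sizes of the rows drop from \<open>c\<close> to \<open>0\<close> somewhere between them, each
  row is copied into the next one, and the excess is at least \<open>c\<close>. Now suppose that
  \<open>n - k < min p c\<close>. Then every prefix has an empty row or a full row, but not both. The
  prefix starts with empty rows and grows by one vertex at a time; a single vertex cannot occupy the
  last empty row and at the same time complete a row. So there is never a full row, and there is
  always an empty one. In the end \<open>k \<le> (p - 1) * (c - 1)\<close>, which contradicts
  \<open>n - k < min p c\<close>. If \<open>c\<close> is even, then the cylinder is bipartite and the same argument applies to
  each of the two parity classes, with rows of length \<open>c div 2\<close>; adding the two bounds gives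
  \<open>2 * min p (c div 2)\<close>.
\<close>

section \<open>Skew zero forcing and legal sequences are dual\<close>

abbreviation nbhds :: "'a pair_pre_digraph \<Rightarrow> 'a set \<Rightarrow> 'a set" where
  "nbhds G S \<equiv> \<Union> (open_nbhd G ` S)"

lemma legal_Nil [simp]: "legal_open_nbhd_sequence G []"
  by (simp add: legal_open_nbhd_sequence_def)

text \<open>
  In this form legality is about sets only, which makes induction on the end of the sequence
  possible; distinctness comes for free, because a repeated vertex has no new neighbour.
\<close>

lemma legal_snoc [simp]:
  "legal_open_nbhd_sequence G (vs @ [v]) \<longleftrightarrow>
     legal_open_nbhd_sequence G vs \<and> v \<in> pverts G \<and> \<not> open_nbhd G v \<subseteq> nbhds G (set vs)"
proof -
  have pre: "(\<Union>j<i. open_nbhd G ((vs @ [v]) ! j)) = (\<Union>j<i. open_nbhd G (vs ! j))"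
    if "i \<le> length vs" for i
    using that by (auto simp: nth_append)
  have all: "(\<Union>j<length vs. open_nbhd G (vs ! j)) = nbhds G (set vs)"
    by (auto simp: set_conv_nth)
  have step: "(\<forall>i < length (vs @ [v]). open_nbhd G ((vs @ [v]) ! i)
        - (\<Union>j<i. open_nbhd G ((vs @ [v]) ! j)) \<noteq> {}) \<longleftrightarrow>
      (\<forall>i < length vs. open_nbhd G (vs ! i) - (\<Union>j<i. open_nbhd G (vs ! j)) \<noteq> {}) \<and>
      \<not> open_nbhd G v \<subseteq> nbhds G (set vs)"
    using pre all by (simp add: less_Suc_eq all_conj_distrib imp_conjL nth_append disj_imp)
  show ?thesis
    unfolding legal_open_nbhd_sequence_def step by auto
qed

lemma legal_filter:
  "legal_open_nbhd_sequence G vs \<Longrightarrow> legal_open_nbhd_sequence G (filter P vs)"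
proof (induction vs rule: rev_induct)
  case (snoc v vs)
  have "nbhds G (set (filter P vs)) \<subseteq> nbhds G (set vs)" by auto
  with snoc show ?case by auto
qed simp

text \<open>
  Each further vertex contributes at least one new neighbour. Read backwards, a long legal
  sequence forces all of its prefixes to have small neighbourhoods.
\<close>

lemma card_nbhds_append:
  assumes "finite (nbhds G (set (xs @ ys)))" "legal_open_nbhd_sequence G (xs @ ys)"
  shows "card (nbhds G (set xs)) + length ys \<le> card (nbhds G (set (xs @ ys)))"
  using assms
proof (induction ys rule: rev_induct)
  case (snoc y ys)
  have legal: "legal_open_nbhd_sequence G (xs @ ys)"
    and new: "\<not> open_nbhd G y \<subseteq> nbhds G (set (xs @ ys))"
    using snoc.prems(2) by (simp_all flip: append_assoc del: set_append)
  have "nbhds G (set (xs @ ys)) \<subset> nbhds G (set (xs @ ys @ [y]))"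
    using new by auto
  then have "card (nbhds G (set (xs @ ys))) < card (nbhds G (set (xs @ ys @ [y])))"
    by (rule psubset_card_mono[OF snoc.prems(1)])
  moreover have "card (nbhds G (set xs)) + length ys \<le> card (nbhds G (set (xs @ ys)))"
    using snoc.IH legal snoc.prems(1) by auto
  ultimately show ?case by simp
qed simp

text \<open>
  The forcing vertices in chronological order: all neighbours of a vertex that has already forced
  are blue, so the white vertex that is forced next is new to their union.
\<close>

lemma legal_sequence_of_forcing:
  assumes "(skew_force G)\<^sup>*\<^sup>* B B'" "finite B"
  shows "\<exists>vs. legal_open_nbhd_sequence G vs \<and> finite B' \<and> card B' = card B + length vs \<and>
           nbhds G (set vs) \<subseteq> B'"
  using assms
proof (induction rule: rtranclp_induct)
  case base
  show ?case using base by (intro exI[of _ "[]"]) simp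
next
  case (step B' B'')
  then obtain vs where vs: "legal_open_nbhd_sequence G vs" "finite B'"
      "card B' = card B + length vs" "nbhds G (set vs) \<subseteq> B'"
    by blast
  from step.hyps(2) obtain u v where u: "u \<in> pverts G" "open_nbhd G u - B' = {v}" "B'' = insert v B'"
    by cases
  then have v: "v \<notin> B'" "v \<in> open_nbhd G u" by auto
  then have "\<not> open_nbhd G u \<subseteq> nbhds G (set vs)" using vs(4) by blast
  with v show ?case
    using vs u by (intro exI[of _ "vs @ [u]"]) (auto simp: card_insert_if)
qed

text \<open>
  \<open>X\<close> collects one private new neighbour for each member of the sequence. A private neighbour of a
  later member is not adjacent to an earlier one, so the first vertex of the sequence sees exactly
  one white vertex, and after its force the second does, and so on. The statement for all \<open>B\<close> that
  contain the remaining neighbours is what the induction needs, since the last vertex of the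
  sequence brings in further neighbours.
\<close>

lemma forcing_of_legal_sequence:
  assumes "legal_open_nbhd_sequence G vs"
  shows "\<exists>X. finite X \<and> card X = length vs \<and> X \<subseteq> nbhds G (set vs) \<and>
           (\<forall>B. nbhds G (set vs) - X \<subseteq> B \<longrightarrow> (skew_force G)\<^sup>*\<^sup>* B (B \<union> X))"
  using assms
proof (induction vs rule: rev_induct)
  case Nil
  show ?case by (intro exI[of _ "{}"]) simp
next
  case (snoc u vs)
  then obtain X where X: "finite X" "card X = length vs" "X \<subseteq> nbhds G (set vs)"
    and force: "\<And>B. nbhds G (set vs) - X \<subseteq> B \<Longrightarrow> (skew_force G)\<^sup>*\<^sup>* B (B \<union> X)"
    by auto
  from snoc.prems obtain v where v: "v \<in> open_nbhd G u" "v \<notin> nbhds G (set vs)"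
    and u: "u \<in> pverts G"
    by auto
  have "(skew_force G)\<^sup>*\<^sup>* B (B \<union> insert v X)"
    if B: "nbhds G (set (vs @ [u])) - insert v X \<subseteq> B" for B
  proof -
    have "(skew_force G)\<^sup>*\<^sup>* B (B \<union> X)"
      using B v by (intro force) auto
    moreover have "(skew_force G)\<^sup>*\<^sup>* (B \<union> X) (B \<union> insert v X)"
    proof (cases "v \<in> B")
      case True
      then show ?thesis by (simp add: insert_absorb)
    next
      case False
      then have "open_nbhd G u - (B \<union> X) = {v}"
        using B X(3) v by auto
      then have "skew_force G (B \<union> X) (insert v (B \<union> X))"
        using u by (rule skew_force.intros[rotated])
      then show ?thesis by auto
    qed
    ultimately show ?thesis by simp
  qed
  then show ?case
    using X v by (intro exI[of _ "insert v X"]) (auto simp: card_insert_if)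
qed

theorem skew_zero_forcing_plus_grundy:
  assumes "pair_graph G"
  shows "skew_zero_forcing_number G + grundy_total_domination_number G = card (pverts G)"
proof -
  interpret pair_graph G by fact
  have fin: "finite (pverts G)" by (rule pair_finite_verts)
  note F = skew_zero_forcing_sets_finite_nonempty[OF fin]
  note L = legal_open_nbhd_sequences_finite_nonempty[OF fin]
  obtain B where B: "skew_zero_forcing_set G B" "card B = skew_zero_forcing_number G"
    using Min_in[OF F] unfolding skew_zero_forcing_number_def by auto
  have "finite B" using B(1) fin finite_subset unfolding skew_zero_forcing_set_def by blast
  then obtain vs where "legal_open_nbhd_sequence G vs" "card (pverts G) = card B + length vs"
    using legal_sequence_of_forcing B(1) unfolding skew_zero_forcing_set_def by blast
  moreover from this have "length vs \<le> grundy_total_domination_number G"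
    unfolding grundy_total_domination_number_def using L(1) by (intro Max_ge) auto
  ultimately have ge: "card (pverts G) \<le> skew_zero_forcing_number G + grundy_total_domination_number G"
    using B(2) by simp
  obtain ws where ws: "legal_open_nbhd_sequence G ws" "length ws = grundy_total_domination_number G"
    using Max_in[OF L] unfolding grundy_total_domination_number_def by auto
  then obtain X where X: "finite X" "card X = length ws" "X \<subseteq> nbhds G (set ws)"
    and force: "\<And>B. nbhds G (set ws) - X \<subseteq> B \<Longrightarrow> (skew_force G)\<^sup>*\<^sup>* B (B \<union> X)"
    using forcing_of_legal_sequence[OF ws(1)] by (elim exE conjE) metis
  have sub: "nbhds G (set ws) \<subseteq> pverts G"
    using wellformed' by (auto simp: open_nbhd_def)
  have "(skew_force G)\<^sup>*\<^sup>* (pverts G - X) (pverts G - X \<union> X)"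
    using sub by (intro force) auto
  moreover have "pverts G - X \<union> X = pverts G" using X(3) sub by auto
  ultimately have "skew_zero_forcing_set G (pverts G - X)"
    by (simp add: skew_zero_forcing_set_def)
  then have "skew_zero_forcing_number G \<le> card (pverts G - X)"
    unfolding skew_zero_forcing_number_def using F(1) by (intro Min_le) auto
  moreover have "card (pverts G - X) = card (pverts G) - length ws" "length ws \<le> card (pverts G)"
    using X sub fin card_mono[of "pverts G" X] by (auto simp: card_Diff_subset)
  ultimately show ?thesis using ge ws(2) by simp
qed

section \<open>Long legal sequences\<close>

text \<open>
  If each \<open>u\<close> in \<open>S\<close> has a neighbour \<open>w u\<close> that is adjacent to no other member of rank at most that
  of \<open>u\<close>, then listing \<open>S\<close> by increasing rank is legal, however ties are broken.
\<close>

lemma legal_sequence_of_ranking: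
  fixes h :: "'a \<Rightarrow> nat"
  assumes "finite S" "S \<subseteq> pverts G"
    and "\<And>u. u \<in> S \<Longrightarrow> w u \<in> open_nbhd G u"
    and "\<And>u u'. u \<in> S \<Longrightarrow> u' \<in> S \<Longrightarrow> h u' \<le> h u \<Longrightarrow> w u \<in> open_nbhd G u' \<Longrightarrow> u' = u"
  shows "\<exists>vs. legal_open_nbhd_sequence G vs \<and> set vs = S \<and> length vs = card S"
  using assms
proof (induction S rule: finite_ranking_induct[where f = h])
  case empty
  show ?case by (intro exI[of _ "[]"]) simp
next
  case (insert u S)
  show ?case
  proof (cases "u \<in> S")
    case True
    then show ?thesis using insert by (simp add: insert_absorb)
  next
    case False
    obtain vs where vs: "legal_open_nbhd_sequence G vs" "set vs = S" "length vs = card S"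
      using insert by (metis insert_iff insert_subset)
    have "w u \<notin> nbhds G S"
    proof
      assume "w u \<in> nbhds G S"
      then obtain u' where "u' \<in> S" "w u \<in> open_nbhd G u'" by blast
      then show False using insert.prems(3)[of u u'] insert.hyps(2) False by auto
    qed
    moreover have "w u \<in> open_nbhd G u" using insert.prems(2) by simp
    ultimately have "legal_open_nbhd_sequence G (vs @ [u])"
      using vs insert.prems(1) by auto
    then show ?thesis using vs insert.hyps(1) False
      by (intro exI[of _ "vs @ [u]"]) simp
  qed
qed

abbreviation cylinder :: "nat \<Rightarrow> nat \<Rightarrow> (nat \<times> nat) pair_pre_digraph" where
  "cylinder p c \<equiv> path_graph p \<box> cycle_graph c"

lemma pverts_cylinder [simp]: "pverts (cylinder p c) = {..<p} \<times> {..<c}"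
  by (simp add: cartesian_product_def path_graph_def cycle_graph_def)

lemma open_nbhd_cylinder:
  "(k, l) \<in> open_nbhd (cylinder p c) (i, j) \<longleftrightarrow>
     i < p \<and> k < p \<and> j < c \<and> l < c \<and>
     (i = k \<and> (l = Suc j mod c \<or> j = Suc l mod c) \<or> j = l \<and> (k = Suc i \<or> i = Suc k))"
  by (auto simp: open_nbhd_def cartesian_product_def path_graph_def cycle_graph_def)

text \<open>
  Row by row, each vertex dominating the one in the next row.
\<close>

lemma legal_sequence_rows:
  "\<exists>vs. legal_open_nbhd_sequence (cylinder p c) vs \<and> length vs = (p - 1) * c"
proof -
  have "\<exists>vs. legal_open_nbhd_sequence (cylinder p c) vs \<and> set vs = {..<p - 1} \<times> {..<c} \<and>
          length vs = card ({..<p - 1} \<times> {..<c})"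
    by (rule legal_sequence_of_ranking[where h = fst and w = "\<lambda>(i, j). (Suc i, j)"])
       (auto simp: open_nbhd_cylinder)
  then show ?thesis by auto
qed

text \<open>
  Column by column, each vertex dominating the next one in its row. Columns \<open>0\<close> and \<open>c - 1\<close> stay
  out of the sequence, which keeps the sweep from meeting itself around the cycle.
\<close>

lemma legal_sequence_columns:
  assumes "c \<ge> 2"
  shows "\<exists>vs. legal_open_nbhd_sequence (cylinder p c) vs \<and> length vs = p * (c - 2)"
proof -
  have "\<exists>vs. legal_open_nbhd_sequence (cylinder p c) vs \<and> set vs = {..<p} \<times> {1..<c - 1} \<and>
          length vs = card ({..<p} \<times> {1..<c - 1})"
  proof (rule legal_sequence_of_ranking[where h = snd and w = "\<lambda>(i, j). (i, Suc j)"])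
    show "(case u of (i, j) \<Rightarrow> (i, Suc j)) \<in> open_nbhd (cylinder p c) u"
      if "u \<in> {..<p} \<times> {1..<c - 1}" for u
      using that by (auto simp: open_nbhd_cylinder)
    show "u' = u" if u: "u \<in> {..<p} \<times> {1..<c - 1}" "u' \<in> {..<p} \<times> {1..<c - 1}"
      and le: "snd u' \<le> snd u"
      and nb: "(case u of (i, j) \<Rightarrow> (i, Suc j)) \<in> open_nbhd (cylinder p c) u'" for u u'
    proof -
      obtain i j k l where [simp]: "u = (i, j)" "u' = (k, l)" by fastforce
      have ran: "Suc j < c" "Suc l < c" "l \<ge> 1" "l \<le> j" using u le by auto
      have "l \<noteq> Suc (Suc j) mod c"
        using ran by (cases "Suc (Suc j) = c") auto
      then show ?thesis using nb ran by (auto simp: open_nbhd_cylinder)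
    qed
  qed auto
  then show ?thesis by (auto simp: numeral_2_eq_2)
qed

text \<open>
  The sweep along columns, carried out in the double cover. The cylinder over the cycle of length
  \<open>2 * c\<close> projects onto the given one, and as \<open>c\<close> is odd, each vertex \<open>(i, j)\<close> has exactly one lift
  whose coordinates have odd sum, namely in column \<open>j\<close> or \<open>j + c\<close>; this column is the rank \<open>h\<close>. The
  vertices left out are those with a lift in column \<open>0\<close> or \<open>2 * c - 1\<close>, one in each row.
\<close>

lemma legal_sequence_double_cover:
  assumes "odd c" "c \<ge> 3"
  shows "\<exists>vs. legal_open_nbhd_sequence (cylinder p c) vs \<and> length vs = p * (c - 1)"
proof -
  define J where "J i = {..<c} - {if odd i then 0 else c - 1}" for i :: nat
  define h where "h = (\<lambda>(i, j). if odd (i + j) then j else j + c)"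
  have "\<exists>vs. legal_open_nbhd_sequence (cylinder p c) vs \<and> set vs = Sigma {..<p} J \<and>
          length vs = card (Sigma {..<p} J)"
  proof (rule legal_sequence_of_ranking[where h = h and w = "\<lambda>(i, j). (i, Suc j mod c)"])
    show "finite (Sigma {..<p} J)" "Sigma {..<p} J \<subseteq> pverts (cylinder p c)"
      by (auto simp: J_def)
    show "(case u of (i, j) \<Rightarrow> (i, Suc j mod c)) \<in> open_nbhd (cylinder p c) u"
      if "u \<in> Sigma {..<p} J" for u
      using that assms by (auto simp: open_nbhd_cylinder J_def)
    show "u' = u" if u: "u \<in> Sigma {..<p} J" "u' \<in> Sigma {..<p} J" and le: "h u' \<le> h u"
      and nb: "(case u of (i, j) \<Rightarrow> (i, Suc j mod c)) \<in> open_nbhd (cylinder p c) u'" for u u'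
    proof -
      obtain i j k l where [simp]: "u = (i, j)" "u' = (k, l)" by fastforce
      have ran: "j < c" "l < c" "odd i \<Longrightarrow> j \<noteq> 0" "even i \<Longrightarrow> j \<noteq> c - 1"
        "odd k \<Longrightarrow> l \<noteq> 0" "even k \<Longrightarrow> l \<noteq> c - 1"
        using u by (auto simp: J_def split: if_splits)
      from nb consider
          (same) "i = k" "Suc j mod c = Suc l mod c"
        | (two) "i = k" "l = Suc (Suc j mod c) mod c"
        | (row) "l = Suc j mod c" "k = Suc i \<or> i = Suc k"
        by (auto simp: open_nbhd_cylinder)
      then show ?thesis
      proof cases
        case same
        then show ?thesis using ran by (auto simp: mod_Suc split: if_splits)
      next
        case two
        \<comment> \<open>Two columns further on, the rank has grown by \<open>2\<close>, across the end of the base cycle as well.\<close>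
        consider "Suc (Suc j) < c" | "Suc (Suc j) = c" | "Suc j = c" using ran(1) by linarith
        then show ?thesis
          using two ran le assms by cases (auto simp: h_def mod_Suc split: if_splits)
      next
        case row
        \<comment> \<open>A vertex of an adjacent row in the next column has its lift one column further on.\<close>
        consider "Suc j < c" | "Suc j = c" using ran(1) by linarith
        then show ?thesis
          using row ran le assms by cases (auto simp: h_def mod_Suc split: if_splits)
      qed
    qed
  qed
  moreover have "card (Sigma {..<p} J) = p * (c - 1)"
    using assms by (simp add: J_def card_Diff_subset)
  ultimately show ?thesis by auto
qed

section \<open>Expansion of vertex sets in the cylinder\<close>

definition cyclic_nbhd :: "nat \<Rightarrow> nat set \<Rightarrow> nat set" where
  "cyclic_nbhd c A = {x. x < c \<and> (\<exists>j\<in>A. x = Suc j mod c \<or> j = Suc x mod c)}"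

lemma inj_on_Suc_mod: "inj_on (\<lambda>j. Suc j mod c) {..<c}"
  by (auto simp: inj_on_def mod_Suc split: if_splits)

text \<open>
  The neighbourhood of \<open>A\<close> on the cycle is the union of its two shifts by one. If it is no larger
  than \<open>A\<close>, the two shifts coincide, so \<open>A\<close> is invariant under the shift by two.
\<close>

lemma card_cyclic_nbhd:
  assumes "A \<subseteq> {..<c}"
  shows "card A \<le> card (cyclic_nbhd c A)"
    and "card (cyclic_nbhd c A) \<le> card A \<Longrightarrow> j \<in> A \<Longrightarrow> (j + 2 * n) mod c \<in> A"
proof -
  let ?s = "\<lambda>j. Suc j mod c"
  have fin: "finite (cyclic_nbhd c A)" by (simp add: cyclic_nbhd_def)
  have inj: "inj_on ?s A" using inj_on_Suc_mod assms inj_on_subset by blast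
  have sub: "?s ` A \<subseteq> cyclic_nbhd c A" using assms by (auto simp: cyclic_nbhd_def)
  show ge: "card A \<le> card (cyclic_nbhd c A)"
    using card_mono[OF fin sub] card_image[OF inj] by simp
  assume le: "card (cyclic_nbhd c A) \<le> card A"
  \<comment> \<open>\<open>?T\<close> is the backward shift of \<open>A\<close>, and the image under \<open>?s\<close> is the forward shift.\<close>
  let ?T = "{x \<in> {..<c}. ?s x \<in> A}"
  have surj: "A \<subseteq> ?s ` ?T"
  proof
    fix j assume j: "j \<in> A"
    then have "j < c" using assms by auto
    define k where "k = (if j = 0 then c - 1 else j - 1)"
    have "?s k = j" "k < c" using \<open>j < c\<close> by (auto simp: k_def)
    then show "j \<in> ?s ` ?T" using j by (intro image_eqI[of _ _ k]) auto
  qed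
  have "card A \<le> card ?T"
    using surj_card_le[OF _ surj] by simp
  then have "?T = cyclic_nbhd c A"
    using le fin by (intro card_seteq) (auto simp: cyclic_nbhd_def)
  with sub have closed: "?s (?s j) \<in> A" if "j \<in> A" for j
    using that by auto
  assume j: "j \<in> A"
  show "(j + 2 * n) mod c \<in> A"
  proof (induction n)
    case 0
    then show ?case using j assms by auto
  next
    case (Suc n)
    have "(j + 2 * Suc n) mod c = ?s (?s ((j + 2 * n) mod c))"
      by (simp add: mod_Suc_eq)
    then show ?case using closed[OF Suc] by simp
  qed
qed

lemma sum_telescope_le:
  fixes s n :: "nat \<Rightarrow> nat"
  assumes "a \<le> b" "\<And>i. a \<le> i \<Longrightarrow> i < b \<Longrightarrow> s i \<le> n (Suc i)"
  shows "s a + (\<Sum>i\<in>{a<..b}. s i) \<le> s b + (\<Sum>i\<in>{a<..b}. n i)"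
  using assms
proof (induction b rule: dec_induct)
  case (step b)
  have "{a<..Suc b} = insert (Suc b) {a<..b}" using step by auto
  then show ?case using step by force
qed simp

lemma sum_telescope_ge:
  fixes s n :: "nat \<Rightarrow> nat"
  assumes "b \<le> a" "\<And>i. b \<le> i \<Longrightarrow> i < a \<Longrightarrow> s (Suc i) \<le> n i"
  shows "s a + (\<Sum>i\<in>{b..<a}. s i) \<le> s b + (\<Sum>i\<in>{b..<a}. n i)"
  using assms
proof (induction a rule: dec_induct)
  case (step a)
  have "s (Suc a) \<le> n a" using step.prems step.hyps by simp
  moreover have "s a + (\<Sum>i\<in>{b..<a}. s i) \<le> s b + (\<Sum>i\<in>{b..<a}. n i)"
    using step by simp
  ultimately show ?case
    using step.hyps unfolding sum.atLeastLessThan_Suc[OF step.hyps(1)] by linarith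
qed simp

text \<open>
  Here \<open>s i\<close> and \<open>n i\<close> will be the numbers of vertices in row \<open>i\<close> of a set and of its neighbourhood.
  On the way from row \<open>a\<close> to row \<open>b\<close>, each row of the neighbourhood is compared with the preceding
  row of the set, and the differences telescope to \<open>s a - s b\<close>; elsewhere rows are compared with
  themselves.
\<close>

lemma sum_excess_ge_drop:
  fixes s n :: "nat \<Rightarrow> nat"
  assumes "a < p" "b < p"
    and self: "\<And>i. i < p \<Longrightarrow> s i \<le> n i"
    and up: "\<And>i. Suc i < p \<Longrightarrow> s i \<le> n (Suc i)"
    and down: "\<And>i. Suc i < p \<Longrightarrow> s (Suc i) \<le> n i"
  shows "s a + (\<Sum>i<p. s i) \<le> s b + (\<Sum>i<p. n i)"
proof -
  have glue: "s a + (\<Sum>i<p. s i) \<le> s b + (\<Sum>i<p. n i)"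
    if I: "I \<subseteq> {..<p}" and "s a + sum s I \<le> s b + sum n I" for I
  proof -
    have "sum s ({..<p} - I) \<le> sum n ({..<p} - I)" by (intro sum_mono) (simp add: self)
    moreover have "sum f {..<p} = sum f ({..<p} - I) + sum f I" for f :: "nat \<Rightarrow> nat"
      using sum.subset_diff[OF I] by simp
    ultimately show ?thesis using that(2) by (smt (verit) add.assoc add.commute add_le_mono)
  qed
  show ?thesis
  proof (cases "a \<le> b")
    case True
    show ?thesis
      using assms(2) by (intro glue[of "{a<..b}"] sum_telescope_le True up) auto
  next
    case False
    then show ?thesis
      using assms(1) by (intro glue[of "{b..<a}"] sum_telescope_ge down) auto
  qed
qed

lemma finite_row:
  fixes S :: "(nat \<times> nat) set"
  assumes "S \<subseteq> {..<p} \<times> {..<c}"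
  shows "finite (S `` {i})"
  by (rule finite_subset[of _ "{..<c}"]) (use assms in auto)

lemma card_eq_sum_rows:
  fixes S :: "(nat \<times> nat) set"
  assumes "S \<subseteq> {..<p} \<times> {..<c}"
  shows "card S = (\<Sum>i<p. card (S `` {i}))"
proof -
  have "S = Sigma {..<p} (\<lambda>i. S `` {i})" using assms by auto
  then have "card S = card (Sigma {..<p} (\<lambda>i. S `` {i}))" by (rule arg_cong)
  then show ?thesis using finite_row[OF assms] by simp
qed

text \<open>
  A class of vertices to which the expansion argument applies: each row contains \<open>m\<close> of them, and
  these form a single orbit under the shift by two. For odd \<open>c\<close> this is the whole cylinder with
  \<open>m = c\<close>, for even \<open>c\<close> it is one of the two parity classes with \<open>m = c div 2\<close>. The bound \<open>m \<ge> 2\<close>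
  ensures that no vertex alone turns an empty row into a full one.
\<close>

locale cylinder_class =
  fixes p c m :: nat and U :: "(nat \<times> nat) set"
  assumes U_sub: "U \<subseteq> {..<p} \<times> {..<c}"
    and row_card: "\<And>i. i < p \<Longrightarrow> card (U `` {i}) = m"
    and row_step: "\<And>i j x. (i, j) \<in> U \<Longrightarrow> (i, x) \<in> U \<Longrightarrow> \<exists>n. (j + 2 * n) mod c = x"
    and p_pos: "p > 0" and m_ge: "m \<ge> 2"
begin

lemma finite_class_row: "S \<subseteq> U \<Longrightarrow> finite (S `` {i})"
  using U_sub finite_row by blast

lemma card_row_le:
  assumes "S \<subseteq> U" "i < p"
  shows "card (S `` {i}) \<le> m"
proof -
  have "card (S `` {i}) \<le> card (U `` {i})"
    using assms(1) by (intro card_mono finite_class_row) auto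
  then show ?thesis using row_card[OF assms(2)] by simp
qed

lemma card_U: "card U = p * m"
  using card_eq_sum_rows[OF U_sub] row_card by simp

text \<open>
  The two situations in which a set expands by much. If every row is proper, each gains a vertex
  inside its own cycle, since a nonempty subset of an orbit that is invariant under the shift by
  two is the whole orbit. If there are a full row and an empty row, the drop of the row sizes between
  them is gained by moving vertices to adjacent rows.
\<close>

lemma excess:
  assumes S: "S \<subseteq> U"
  defines "s \<equiv> \<lambda>i. card (S `` {i})"
  shows "(\<And>i. i < p \<Longrightarrow> 0 < s i \<and> s i < m) \<Longrightarrow> card S + p \<le> card (nbhds (cylinder p c) S)"
    and "a < p \<Longrightarrow> b < p \<Longrightarrow> s a = m \<Longrightarrow> s b = 0 \<Longrightarrow> card S + m \<le> card (nbhds (cylinder p c) S)"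
proof -
  define N where "N = nbhds (cylinder p c) S"
  define n where "n = (\<lambda>i. card (N `` {i}))"
  have N_sub: "N \<subseteq> {..<p} \<times> {..<c}"
    by (auto simp: N_def open_nbhd_cylinder)
  have fin: "finite (N `` {i})" for i using finite_row[OF N_sub] .
  have S_sub: "S \<subseteq> {..<p} \<times> {..<c}" using S U_sub by blast
  have cardS: "card S = sum s {..<p}" and cardN: "card N = sum n {..<p}"
    using card_eq_sum_rows[OF S_sub] card_eq_sum_rows[OF N_sub] by (simp_all add: s_def n_def)
  have row: "cyclic_nbhd c (S `` {i}) \<subseteq> N `` {i}" if "i < p" for i
    unfolding N_def cyclic_nbhd_def using that S_sub by (force simp: open_nbhd_cylinder)
  have A: "S `` {i} \<subseteq> {..<c}" for i using S_sub by auto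
  have cyc: "card (cyclic_nbhd c (S `` {i})) \<le> n i" if "i < p" for i
    unfolding n_def by (intro card_mono fin row that)
  have self: "s i \<le> n i" if "i < p" for i
    using card_cyclic_nbhd(1)[OF A] cyc[OF that] unfolding s_def by (rule order_trans)
  have proper: "Suc (s i) \<le> n i" if i: "i < p" and "0 < s i" "s i < m" for i
  proof (rule ccontr)
    assume "\<not> Suc (s i) \<le> n i"
    then have le: "card (cyclic_nbhd c (S `` {i})) \<le> card (S `` {i})"
      using cyc[OF i] unfolding s_def by linarith
    obtain j where j: "(i, j) \<in> S"
      using \<open>0 < s i\<close> unfolding s_def by (auto simp: card_gt_0_iff)
    have "U `` {i} \<subseteq> S `` {i}"
    proof
      fix x assume "x \<in> U `` {i}"
      then obtain k where "(j + 2 * k) mod c = x" using row_step[of i j x] j S by auto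
      then show "x \<in> S `` {i}" using card_cyclic_nbhd(2)[OF A le, of j k] j by auto
    qed
    then have "m \<le> s i"
      using card_mono[OF finite_class_row[OF S], of "U `` {i}" i] row_card[OF i] by (simp add: s_def)
    then show False using \<open>s i < m\<close> by simp
  qed
  show "card S + p \<le> card (nbhds (cylinder p c) S)" if "\<And>i. i < p \<Longrightarrow> 0 < s i \<and> s i < m"
  proof -
    have "(\<Sum>i<p. s i + 1) \<le> (\<Sum>i<p. n i)"
      using that proper by (intro sum_mono) auto
    then show ?thesis unfolding N_def[symmetric] cardS cardN by (simp add: sum_Suc)
  qed
  have up: "s i \<le> n (Suc i)" if "Suc i < p" for i
    unfolding s_def n_def using that S_sub
    by (intro card_mono fin) (force simp: N_def open_nbhd_cylinder)
  have down: "s (Suc i) \<le> n i" if "Suc i < p" for i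
    unfolding s_def n_def using that S_sub
    by (intro card_mono fin) (force simp: N_def open_nbhd_cylinder)
  show "card S + m \<le> card (nbhds (cylinder p c) S)" if "a < p" "b < p" "s a = m" "s b = 0"
    using sum_excess_ge_drop[of a p b s n, OF that(1,2) self up down] that(3,4)
    unfolding N_def[symmetric] cardS cardN by simp
qed

text \<open>
  Below the bound, every prefix of the sequence avoids both cases of \<open>excess\<close>. By induction on the
  prefix, it therefore always has an empty row and never a full one, and the sequence is too short to
  violate the bound.
\<close>

lemma length_legal_le:
  assumes legal: "legal_open_nbhd_sequence (cylinder p c) vs" and vs: "set vs \<subseteq> U"
    and W: "finite W" "card W = p * m" "nbhds (cylinder p c) U \<subseteq> W"
  shows "length vs + min p m \<le> p * m"
proof (rule ccontr)
  assume long: "\<not> length vs + min p m \<le> p * m"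
  have small: "card (nbhds (cylinder p c) (set xs)) < card (set xs) + min p m"
    if "vs = xs @ ys" for xs ys
  proof -
    have sub: "nbhds (cylinder p c) (set vs) \<subseteq> W" using vs W(3) by blast
    then have "card (nbhds (cylinder p c) (set vs)) \<le> p * m"
      using card_mono[OF W(1) sub] W(2) by simp
    moreover have "finite (nbhds (cylinder p c) (set vs))"
      using sub W(1) finite_subset by blast
    then have "card (nbhds (cylinder p c) (set xs)) + length ys
        \<le> card (nbhds (cylinder p c) (set vs))"
      using card_nbhds_append[of "cylinder p c" xs ys] legal unfolding that by blast
    moreover have "distinct xs"
      using legal unfolding that legal_open_nbhd_sequence_def by simp
    then have "length vs = card (set xs) + length ys"
      using that by (simp add: distinct_card)
    ultimately show ?thesis using long by linarith
  qed
  have "(\<exists>b<p. set xs `` {b} = {}) \<and> (\<forall>a<p. card (set xs `` {a}) < m)"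
    if "vs = xs @ ys" for xs ys
    using that
  proof (induction xs arbitrary: ys rule: rev_induct)
    case Nil
    then show ?case using p_pos m_ge by auto
  next
    case (snoc x xs)
    obtain b where b: "b < p" "set xs `` {b} = {}" and less: "\<forall>a<p. card (set xs `` {a}) < m"
      using snoc.IH[of "x # ys"] snoc.prems by auto
    let ?S = "set (xs @ [x])"
    have S: "?S \<subseteq> U" using vs snoc.prems by auto
    have sm: "card (nbhds (cylinder p c) ?S) < card ?S + min p m"
      using small snoc.prems by blast
    obtain i j where x: "x = (i, j)" by (cases x)
    have img: "?S `` {a} = (if a = i then insert j (set xs `` {a}) else set xs `` {a})" for a
      by (auto simp: x)
    \<comment> \<open>If the new vertex completes its row, that row was nonempty before, so the empty row is another one.\<close>
    have nofull: "card (?S `` {a}) < m" if a: "a < p" for a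
    proof (rule ccontr)
      assume "\<not> card (?S `` {a}) < m"
      then have full: "card (?S `` {a}) = m" using card_row_le[OF S a] by simp
      then have "a = i" using less a unfolding img by (auto split: if_splits)
      moreover have "b \<noteq> i"
      proof
        assume "b = i"
        then have "card (?S `` {a}) = 1" unfolding \<open>a = i\<close> using b(2) unfolding img by simp
        then show False using full m_ge by simp
      qed
      ultimately have "card (?S `` {b}) = 0" unfolding img using b(2) by simp
      then show False using excess(2)[OF S a b(1) full] sm by simp
    qed
    moreover have "\<exists>b<p. ?S `` {b} = {}"
    proof (rule ccontr)
      assume "\<not> ?thesis"
      then have "\<And>i. i < p \<Longrightarrow> 0 < card (?S `` {i}) \<and> card (?S `` {i}) < m"
        using nofull finite_class_row[OF S] by (metis card_gt_0_iff)
      then show False using excess(1)[OF S] sm by simp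
    qed
    ultimately show ?case by blast
  qed
  from this[of vs "[]"] obtain b where b: "b < p" "set vs `` {b} = {}"
    and less: "\<forall>a<p. card (set vs `` {a}) < m"
    by auto
  have "length vs = card (set vs)"
    using legal by (simp add: legal_open_nbhd_sequence_def distinct_card)
  also have "\<dots> = (\<Sum>i<p. card (set vs `` {i}))"
    using vs U_sub by (intro card_eq_sum_rows) auto
  also have "\<dots> = (\<Sum>i\<in>{..<p} - {b}. card (set vs `` {i}))"
    using b by (simp add: sum.remove[of "{..<p}" b])
  also have "\<dots> \<le> (\<Sum>i\<in>{..<p} - {b}. m - 1)"
    using less by (intro sum_mono) fastforce
  also have "\<dots> = (p - 1) * (m - 1)" using b by simp
  finally have "length vs \<le> (p - 1) * (m - 1)" .
  moreover have "(p - 1) * (m - 1) + m \<le> p * m"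
    using p_pos by (cases p) auto
  ultimately show False using long by linarith
qed

end

section \<open>The bound for odd and for even cycles\<close>

lemma length_legal_odd:
  assumes "p \<ge> 1" "odd c" "c \<ge> 3" "legal_open_nbhd_sequence (cylinder p c) vs"
  shows "length vs + min p c \<le> p * c"
proof -
  interpret cylinder_class p c c "{..<p} \<times> {..<c}"
  proof
    fix i j x assume "(i, j) \<in> {..<p} \<times> {..<c}" "(i, x) \<in> {..<p} \<times> {..<c}"
    then have jx: "j < c" "x < c" by auto
    \<comment> \<open>Going around the odd cycle once more changes the parity of the distance from \<open>j\<close> to \<open>x\<close>.\<close>
    define e where "e = (if even (x + c - j) then 1 else 2 :: nat)"
    have "even (x + e * c - j)" using jx \<open>odd c\<close> by (auto simp: e_def)
    then obtain n where n: "x + e * c - j = 2 * n" by blast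
    have "j \<le> x + e * c" using jx by (auto simp: e_def)
    then have "j + 2 * n = x + e * c" using n by simp
    then show "\<exists>n. (j + 2 * n) mod c = x" using jx by (metis mod_less mod_mult_self1)
  next
    fix i assume "i < p"
    then have "({..<p} \<times> {..<c}) `` {i} = {..<c}" by auto
    then show "card (({..<p} \<times> {..<c}) `` {i}) = c" by simp
  qed (use assms in auto)
  show ?thesis
    using assms(4)
    by (rule length_legal_le[where W = "{..<p} \<times> {..<c}"])
       (use assms(4) in \<open>auto simp: legal_open_nbhd_sequence_def open_nbhd_cylinder\<close>)
qed

lemma card_parity_class: "card {j. j < 2 * m \<and> even (i + j) = e} = m" for i m :: nat
proof -
  define b where "b = (if even i = e then 0 else 1 :: nat)"
  have "{j. j < 2 * m \<and> even (i + j) = e} = (\<lambda>k. 2 * k + b) ` {..<m}"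
  proof (intro set_eqI iffI)
    fix j assume "j \<in> {j. j < 2 * m \<and> even (i + j) = e}"
    then have "j = 2 * (j div 2) + b" "j div 2 < m" by (auto simp: b_def split: if_splits)
    then show "j \<in> (\<lambda>k. 2 * k + b) ` {..<m}" by blast
  qed (auto simp: b_def split: if_splits)
  moreover have "inj_on (\<lambda>k. 2 * k + b) {..<m}" by (auto simp: inj_on_def)
  ultimately show ?thesis by (simp add: card_image)
qed

lemma length_legal_even:
  assumes "p \<ge> 1" "m \<ge> 2" "legal_open_nbhd_sequence (cylinder p (2 * m)) vs"
  shows "length vs + min (2 * p) (2 * m) \<le> p * (2 * m)"
proof -
  define U where "U e = {(i, j). i < p \<and> j < 2 * m \<and> even (i + j) = e}" for e
  have cls: "cylinder_class p (2 * m) m (U e)" for e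
  proof
    fix i j x assume "(i, j) \<in> U e" "(i, x) \<in> U e"
    then have jx: "j < 2 * m" "x < 2 * m" "even (x + 2 * m - j)" by (auto simp: U_def)
    then obtain n where "x + 2 * m - j = 2 * n" by blast
    then have "j + 2 * n = x + 2 * m" using jx by simp
    then show "\<exists>n. (j + 2 * n) mod (2 * m) = x" using jx by (metis mod_add_self2 mod_less)
  next
    fix i assume "i < p"
    then show "card (U e `` {i}) = m"
      using card_parity_class[of m i e] by (simp add: U_def Image_def)
  qed (use assms in \<open>auto simp: U_def\<close>)
  have half: "length (filter (\<lambda>v. v \<in> U e) vs) + min p m \<le> p * m" for e
  proof (rule cylinder_class.length_legal_le[OF cls])
    show "legal_open_nbhd_sequence (cylinder p (2 * m)) (filter (\<lambda>v. v \<in> U e) vs)"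
      using assms(3) by (rule legal_filter)
    show "set (filter (\<lambda>v. v \<in> U e) vs) \<subseteq> U e" by auto
    show "finite (U (\<not> e))"
      by (rule finite_subset[of _ "{..<p} \<times> {..<2 * m}"]) (auto simp: U_def)
    show "card (U (\<not> e)) = p * m"
      using cylinder_class.card_U[OF cls] .
    have parity: "even (x mod (2 * m)) \<longleftrightarrow> even x" for x
      by (simp add: dvd_mod_iff)
    have "(k, l) \<in> U (\<not> e)"
      if "(i, j) \<in> U e" "(k, l) \<in> open_nbhd (cylinder p (2 * m)) (i, j)" for i j k l
      using that parity[of "Suc j"] parity[of "Suc l"]
      unfolding U_def open_nbhd_cylinder by auto
    then show "nbhds (cylinder p (2 * m)) (U e) \<subseteq> U (\<not> e)" by fast
  qed
  have "v \<in> U False \<longleftrightarrow> v \<notin> U True" if "v \<in> set vs" for v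
    using assms(3) that by (auto simp: legal_open_nbhd_sequence_def U_def)
  then have "filter (\<lambda>v. v \<in> U False) vs = filter (\<lambda>v. v \<notin> U True) vs"
    by (intro filter_cong) auto
  then have "length vs = length (filter (\<lambda>v. v \<in> U True) vs) + length (filter (\<lambda>v. v \<in> U False) vs)"
    using sum_length_filter_compl[of "\<lambda>v. v \<in> U True" vs] by simp
  then show ?thesis using half[of True] half[of False] by linarith
qed

lemma grundy_total_domination_number_cylinder:
  assumes "p \<ge> 1" "c \<ge> 3"
  shows "grundy_total_domination_number (cylinder p c) = p * c - q p c"
proof -
  let ?L = "{length vs | vs. legal_open_nbhd_sequence (cylinder p c) vs}"
  have upper: "length vs \<le> p * c - q p c" if legal: "legal_open_nbhd_sequence (cylinder p c) vs" for vs
  proof (cases "odd c")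
    case True
    then show ?thesis using length_legal_odd[OF assms(1) _ assms(2) legal] by (simp add: q_def)
  next
    case False
    then obtain m where "c = 2 * m" by blast
    then show ?thesis
      using length_legal_even[of p m vs] assms legal by (simp add: q_def)
  qed
  have rows: "(p - 1) * c = p * c - c" by (simp add: diff_mult_distrib)
  have "p * c - q p c \<in> ?L"
  proof (cases "c \<le> q p c")
    case True
    then have "q p c = c" by (auto simp: q_def split: if_splits)
    then have "p * c - q p c = (p - 1) * c" using rows by simp
    then show ?thesis using legal_sequence_rows[of p c] by (metis (mono_tags, lifting) mem_Collect_eq)
  next
    case False
    show ?thesis
    proof (cases "odd c")
      case True
      then have "p * c - q p c = p * (c - 1)"
        using False by (auto simp: q_def diff_mult_distrib2 min_def split: if_splits)
      then show ?thesis using legal_sequence_double_cover[OF True assms(2), of p]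
        by (metis (mono_tags, lifting) mem_Collect_eq)
    next
      case even: False
      then have "p * c - q p c = p * (c - 2)"
        using False by (auto simp: q_def diff_mult_distrib2 min_def split: if_splits)
      then show ?thesis using legal_sequence_columns[of c p] assms(2)
        by (metis (mono_tags, lifting) mem_Collect_eq Suc_leD numeral_3_eq_3 numeral_2_eq_2)
    qed
  qed
  moreover have "finite ?L"
    using legal_open_nbhd_sequences_finite_nonempty(1)[of "cylinder p c"] by simp
  ultimately show ?thesis
    unfolding grundy_total_domination_number_def
    using upper by (intro Max_eqI) auto
qed

theorem theorem1p2:
  fixes p c :: nat
  assumes "p \<ge> 2" and "c \<ge> 3"
  shows "skew_zero_forcing_number (path_graph p \<box> cycle_graph c) = q p c \<and>
         grundy_total_domination_number (path_graph p \<box> cycle_graph c) = p * c - q p c"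
proof -
  have "pair_graph (cylinder p c)"
    using assms by (intro pair_graph_cartesian_product pair_graph_path_graph pair_graph_cycle_graph) simp
  from skew_zero_forcing_plus_grundy[OF this]
  have "skew_zero_forcing_number (cylinder p c) + grundy_total_domination_number (cylinder p c) = p * c"
    by simp
  moreover have "grundy_total_domination_number (cylinder p c) = p * c - q p c"
    using assms by (intro grundy_total_domination_number_cylinder) auto
  moreover have "q p c \<le> p * c" using assms by (intro q_le) simp
  ultimately show ?thesis by simp
qed

end
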